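(* Let $p$ be a prime, and let $F_1(x),\ldots,F_m(x)\in\overline{\mathbb{Q}}_p[x]$ with $\deg F_k\leqslant l_k\in\mathbb{N}$ and $F_k(a)\in\overline{\mathbb{Z}}_p$ for all $a\in\mathbb{Z}$ ($k=1,\ldots,m$). Let $a_1,\ldots,a_m\in\mathbb{N}$, and let $f_1(x_1,\ldots,x_n),\ldots,f_m(x_1,\ldots,x_n)$ be nonzero polynomials with integer coefficients. Let $d_k=\deg f_k$ (total degree) for $k=1,\ldots,m$, and assume that $d_1\varphi(p^{a_1})=\max_{1\leqslant k\leqslant m}d_k\varphi(p^{a_k})$. Let $b\in\mathbb{Z}^+$ and suppose that $$n>(b-1)\max\left\{\frac{d_1\varphi(p^{a_1})}{p-1},1\right\}+\frac1{p-1}\sum_{k=1}^m\bigl((l_k+1)p^{a_k}-[\![a_k\neq0]\!]\bigr)d_k,$$ where $[\![a_k\neq 0]\!]$ equals $1$ if $a_k\neq0$ and $0$ otherwise. Then $$\sum_{\substack{x_1,\ldots,x_n\in[0,p-1]\\ p^{a_k}\mid f_k(x_1,\ldots,x_n)\text{ for all }k\in[1,m]}}\ \prod_{k=1}^m F_k\left(\frac{f_k(x_1,\ldots,x_n)}{p^{a_k}}\right)\equiv0\pmod{p^b}.$$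
   Context: $\overline{\mathbb{Q}}_p$ is the algebraic closure of $\mathbb{Q}_p$ and $\overline{\mathbb{Z}}_p$ is the ring of $p$-adic algebraic integers in $\overline{\mathbb{Q}}_p$. For $\alpha\in\overline{\mathbb{Z}}_p$, $\alpha\equiv 0\pmod{p^b}$ means $\alpha/p^b\in\overline{\mathbb{Z}}_p$. $\mathbb{N}=\{0,1,2,\ldots\}$, $\mathbb{Z}^+=\{1,2,\ldots\}$, $[m,n]=\{x\in\mathbb{Z}: m\leqslant x\leqslant n\}$, and $\varphi$ is Euler's totient function (with $\varphi(1)=1$). *)

theory Defs
  imports
    Complex_Main
    "HOL-Library.Poly_Mapping"
    "HOL-Library.FuncSet"
    "HOL-Computational_Algebra.Computational_Algebra"
    "HOL-Number_Theory.Totient"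
    "HOL-Algebra.Algebraic_Closure_Type"
    "Berlekamp_Zassenhaus.Finite_Field"
begin

text \<open>
  The prime \<open>p\<close> is carried by a type \<open>'p\<close> of class \<open>prime_card\<close>, with \<open>p = CARD('p)\<close>.
  The ring of \<open>p\<close>-adic integers is the inverse limit of the rings of integers modulo \<open>p ^ n\<close>:
  a sequence \<open>x\<close> with \<open>x n\<close> the representative in \<open>{0..<p ^ n}\<close> of the \<open>n\<close>-th component.
  The case \<open>m = n\<close> of the defining condition says that \<open>x n\<close> is reduced.
\<close>

typedef ('p::prime_card) padic_int =
  "{x :: nat \<Rightarrow> int. \<forall>n. \<forall>m\<le>n. x n mod int CARD('p) ^ m = x m}"
  by (rule exI[of _ "\<lambda>_. 0"]) simp

setup_lifting type_definition_padic_int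

lemma mod_power_mod_power_le:
  fixes a q :: int
  assumes "m \<le> n"
  shows "a mod q ^ n mod q ^ m = a mod q ^ m"
  using assms by (simp add: le_imp_power_dvd mod_mod_cancel)

lemma padic_compat_add:
  fixes x y :: "nat \<Rightarrow> int" and q :: int
  assumes "\<forall>n. \<forall>m\<le>n. x n mod q ^ m = x m" "\<forall>n. \<forall>m\<le>n. y n mod q ^ m = y m" "m \<le> n"
  shows "(x n + y n) mod q ^ n mod q ^ m = (x m + y m) mod q ^ m"
  using assms by (metis mod_add_eq mod_power_mod_power_le)

lemma padic_compat_diff:
  fixes x y :: "nat \<Rightarrow> int" and q :: int
  assumes "\<forall>n. \<forall>m\<le>n. x n mod q ^ m = x m" "\<forall>n. \<forall>m\<le>n. y n mod q ^ m = y m" "m \<le> n"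
  shows "(x n - y n) mod q ^ n mod q ^ m = (x m - y m) mod q ^ m"
  using assms by (metis mod_diff_eq mod_power_mod_power_le)

lemma padic_compat_mult:
  fixes x y :: "nat \<Rightarrow> int" and q :: int
  assumes "\<forall>n. \<forall>m\<le>n. x n mod q ^ m = x m" "\<forall>n. \<forall>m\<le>n. y n mod q ^ m = y m" "m \<le> n"
  shows "(x n * y n) mod q ^ n mod q ^ m = (x m * y m) mod q ^ m"
  using assms by (metis mod_mult_eq mod_power_mod_power_le)

lemma padic_compat_uminus:
  fixes x :: "nat \<Rightarrow> int" and q :: int
  assumes "\<forall>n. \<forall>m\<le>n. x n mod q ^ m = x m" "m \<le> n"
  shows "(- x n) mod q ^ n mod q ^ m = (- x m) mod q ^ m"
  using assms by (metis mod_minus_eq mod_power_mod_power_le)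

instantiation padic_int :: (prime_card) comm_ring_1
begin

lift_definition zero_padic_int :: "'a padic_int" is "\<lambda>_. 0" by simp

lift_definition one_padic_int :: "'a padic_int" is "\<lambda>n. 1 mod int CARD('a) ^ n"
  by (simp add: mod_power_mod_power_le)

lift_definition plus_padic_int :: "'a padic_int \<Rightarrow> 'a padic_int \<Rightarrow> 'a padic_int"
  is "\<lambda>x y n. (x n + y n) mod int CARD('a) ^ n"
  by (simp add: padic_compat_add)

lift_definition minus_padic_int :: "'a padic_int \<Rightarrow> 'a padic_int \<Rightarrow> 'a padic_int"
  is "\<lambda>x y n. (x n - y n) mod int CARD('a) ^ n"
  by (simp add: padic_compat_diff)

lift_definition uminus_padic_int :: "'a padic_int \<Rightarrow> 'a padic_int"
  is "\<lambda>x n. (- x n) mod int CARD('a) ^ n"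
  by (simp add: padic_compat_uminus)

lift_definition times_padic_int :: "'a padic_int \<Rightarrow> 'a padic_int \<Rightarrow> 'a padic_int"
  is "\<lambda>x y n. (x n * y n) mod int CARD('a) ^ n"
  by (simp add: padic_compat_mult)

instance
proof
  fix a b c :: "'a padic_int"
  show "a + b + c = a + (b + c)"
    by transfer (simp add: fun_eq_iff mod_simps algebra_simps)
  show "a + b = b + a"
    by transfer (simp add: algebra_simps)
  show "0 + a = a"
    by transfer simp
  show "- a + a = 0"
    by transfer (simp add: fun_eq_iff mod_simps)
  show "a - b = a + - b"
    by transfer (simp add: fun_eq_iff mod_simps)
  show "a * b * c = a * (b * c)"
    by transfer (simp add: fun_eq_iff mod_simps algebra_simps)
  show "a * b = b * a"
    by transfer (simp add: algebra_simps)
  show "1 * a = a"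
    by transfer (simp add: fun_eq_iff mod_simps)
  show "(a + b) * c = a * c + b * c"
    by transfer (simp add: fun_eq_iff mod_simps algebra_simps)
  show "(0::'a padic_int) \<noteq> 1"
  proof transfer
    have "1 < int CARD('a)"
      using prime_card_int[where 'a = 'a] prime_gt_1_int by blast
    then show "(\<lambda>_. 0) \<noteq> (\<lambda>n. 1 mod int CARD('a) ^ n)"
      by (auto simp: fun_eq_iff intro!: exI[of _ 1])
  qed
qed

end

instance padic_int :: (prime_card) idom
proof
  fix a b :: "'a padic_int"
  assume "a \<noteq> 0" and "b \<noteq> 0"
  then show "a * b \<noteq> 0"
  proof transfer
    fix x y :: "nat \<Rightarrow> int"
    let ?p = "int CARD('a)"
    assume x: "\<forall>n. \<forall>m\<le>n. x n mod ?p ^ m = x m" and y: "\<forall>n. \<forall>m\<le>n. y n mod ?p ^ m = y m"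
      and "x \<noteq> (\<lambda>_. 0)" and "y \<noteq> (\<lambda>_. 0)"
    then obtain i j where ij: "x i \<noteq> 0" "y j \<noteq> 0" by (auto simp: fun_eq_iff)
    have "x 0 = 0" using x by (metis mod_by_1 order_refl power_0)
    with ij have "i \<noteq> 0" by metis
    then have "i + j = Suc (i + j - 1)" by simp
    have nx: "\<not> ?p ^ i dvd x (i + j)" using x ij(1) by (metis dvd_imp_mod_0 le_add1)
    have ny: "\<not> ?p ^ j dvd y (i + j)" using y ij(2) by (metis dvd_imp_mod_0 le_add2)
    have "prime_elem ?p" using prime_card_int by blast
    have "\<not> ?p ^ (i + j) dvd x (i + j) * y (i + j)"
    proof
      assume "?p ^ (i + j) dvd x (i + j) * y (i + j)"
      then have "?p ^ (i + j - 1) dvd x (i + j) * y (i + j)"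
        by (meson diff_le_self le_imp_power_dvd dvd_trans)
      with \<open>prime_elem ?p\<close> have "?p ^ i dvd x (i + j) \<or> ?p ^ j dvd y (i + j)"
        using \<open>i + j = Suc (i + j - 1)\<close> prime_elem_power_dvd_cases by blast
      with nx ny show False by blast
    qed
    then show "(\<lambda>n. x n * y n mod ?p ^ n) \<noteq> (\<lambda>_. 0)"
      by (auto simp: fun_eq_iff dvd_eq_mod_eq_0)
  qed
qed

type_synonym 'p padic = "'p padic_int fract"

type_synonym 'p padic_closure = "'p padic alg_closure"

text \<open>The integral closure of the \<open>p\<close>-adic integers in the algebraic closure of their field of fractions.\<close>

definition padic_algebraic_ints :: "'p::prime_card padic_closure set" where
  "padic_algebraic_ints =
     {\<alpha>. \<exists>q :: 'p padic_int poly. lead_coeff q = 1 \<and> poly (map_poly (to_ac \<circ> to_fract) q) \<alpha> = 0}"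

text \<open>
  A multivariate polynomial is a finitely supported map from monomials to coefficients, a monomial
  being a finitely supported map from variable indices to exponents.
\<close>

type_synonym int_mpoly = "(nat \<Rightarrow>\<^sub>0 nat) \<Rightarrow>\<^sub>0 int"

definition monom_degree :: "(nat \<Rightarrow>\<^sub>0 nat) \<Rightarrow> nat" where
  "monom_degree t = (\<Sum>i\<in>Poly_Mapping.keys t. Poly_Mapping.lookup t i)"

definition mpoly_vars :: "int_mpoly \<Rightarrow> nat set" where
  "mpoly_vars f = (\<Union>t\<in>Poly_Mapping.keys f. Poly_Mapping.keys t)"

definition mpoly_total_degree :: "int_mpoly \<Rightarrow> nat" where
  "mpoly_total_degree f = Max (insert 0 (monom_degree ` Poly_Mapping.keys f))"

definition mpoly_eval :: "int_mpoly \<Rightarrow> (nat \<Rightarrow> int) \<Rightarrow> int" where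
  "mpoly_eval f x =
     (\<Sum>t\<in>Poly_Mapping.keys f. Poly_Mapping.lookup f t *
        (\<Prod>i\<in>Poly_Mapping.keys t. x i ^ Poly_Mapping.lookup t i))"

end

theory Submission
  imports Defs "HOL.Binomial_Plus" "Jordan_Normal_Form.Char_Poly"
begin

text \<open>
  Put \<open>g\<^sub>k y = F\<^sub>k (y / p ^ a\<^sub>k)\<close> if \<open>p ^ a\<^sub>k\<close> divides \<open>y\<close>, and \<open>0\<close> otherwise, so that the sum is
  \<open>\<Sum>x. \<Prod>k. g\<^sub>k (f\<^sub>k x)\<close> over the whole box. Newton's forward difference formula at a base point
  \<open>- C\<close> below all values of the \<open>f\<^sub>k\<close> turns it into a sum over multi-indices \<open>J\<close> of
  \<open>\<Prod>k. (\<Delta> ^ J\<^sub>k g\<^sub>k) (- C)\<close> times the integer \<open>\<Sum>x. \<Prod>k. (f\<^sub>k x + C choose J\<^sub>k)\<close>.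
  By a Fleck-type congruence, \<open>\<Delta> ^ j g\<^sub>k\<close> is divisible by a power of \<open>p\<close> that grows with \<open>j\<close> at
  rate \<open>1 / \<phi>(p ^ a\<^sub>k)\<close>. The second factor sums an integer-valued polynomial of degree
  \<open>D = \<Sum>k. d\<^sub>k J\<^sub>k\<close> over the box \<open>[0, p - 1]\<^sup>n\<close>, hence is divisible by \<open>p\<close> to the power
  \<open>n - \<lfloor>D / (p - 1)\<rfloor>\<close>. The hypothesis on \<open>n\<close> says that the two exponents always add up to at least \<open>b\<close>.
\<close>

section \<open>Forward differences\<close>

definition fdiff :: "(int \<Rightarrow> 'a::ab_group_add) \<Rightarrow> int \<Rightarrow> 'a" where
  "fdiff g = (\<lambda>y. g (y + 1) - g y)"

lemma fdiff_zero [simp]: "fdiff (\<lambda>_. 0) = (\<lambda>_. 0)"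
  by (simp add: fdiff_def)

lemma fdiff_funpow_zero [simp]: "(fdiff ^^ j) (\<lambda>_. 0) = (\<lambda>_. 0)"
  by (induction j) simp_all

text \<open>Binomial expansion of the N-th power of the shift 1 + \<open>fdiff\<close>: one more
  shift adds the expansion of \<open>fdiff g\<close>, and Pascal's rule merges the two sums.\<close>

lemma newton_forward:
  fixes g :: "int \<Rightarrow> 'a::comm_ring_1"
  shows "g (y + int N) = (\<Sum>j\<le>N. of_nat (N choose j) * (fdiff ^^ j) g y)"
proof (induction N arbitrary: g)
  case 0
  then show ?case by simp
next
  case (Suc N)
  let ?D = "\<lambda>j. (fdiff ^^ j) g y"
  have "g (y + int (Suc N)) = g (y + int N) + fdiff g (y + int N)"
    by (simp add: fdiff_def algebra_simps)
  also have "\<dots> = (\<Sum>j\<le>N. of_nat (N choose j) * ?D j)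
      + (\<Sum>j\<le>N. of_nat (N choose j) * ?D (Suc j))"
    using Suc[of g] Suc[of "fdiff g"] by (simp add: funpow_swap1)
  also have "(\<Sum>j\<le>N. of_nat (N choose j) * ?D j) = (\<Sum>j\<le>Suc N. of_nat (N choose j) * ?D j)"
    by (simp add: binomial_eq_0)
  also have "\<dots> = ?D 0 + (\<Sum>j\<le>N. of_nat (N choose Suc j) * ?D (Suc j))"
    by (subst sum.atMost_Suc_shift) simp
  finally have "g (y + int (Suc N)) = ?D 0 + (\<Sum>j\<le>N. of_nat (Suc N choose Suc j) * ?D (Suc j))"
    by (simp add: algebra_simps sum.distrib)
  then show ?case
    by (subst sum.atMost_Suc_shift) simp
qed

text \<open>Each value is expanded at the base point 0; summing the binomials over t raises the
  lower index by one.\<close>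

lemma sum_newton_forward:
  fixes g :: "int \<Rightarrow> 'a::comm_ring_1"
  shows "(\<Sum>t<N. g (int t)) = (\<Sum>s<N. of_nat (N choose Suc s) * (fdiff ^^ s) g 0)"
proof -
  have "g (int t) = (\<Sum>s<N. of_nat (t choose s) * (fdiff ^^ s) g 0)" if "t < N" for t
  proof -
    have "(\<Sum>s<N. of_nat (t choose s) * (fdiff ^^ s) g 0)
        = (\<Sum>s\<le>t. of_nat (t choose s) * (fdiff ^^ s) g 0)"
      using that by (intro sum.mono_neutral_right) (auto simp: binomial_eq_0 not_le)
    with newton_forward[of g 0 t] show ?thesis by simp
  qed
  then have "(\<Sum>t<N. g (int t)) = (\<Sum>t<N. \<Sum>s<N. of_nat (t choose s) * (fdiff ^^ s) g 0)"
    by simp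
  also have "\<dots> = (\<Sum>s<N. of_nat (\<Sum>t<N. t choose s) * (fdiff ^^ s) g 0)"
    by (subst sum.swap) (simp add: sum_distrib_right)
  also have "\<dots> = (\<Sum>s<N. of_nat (N choose Suc s) * (fdiff ^^ s) g 0)"
  proof (cases N)
    case (Suc N')
    then show ?thesis using sum_choose_upper[of _ N'] by (simp only: lessThan_Suc_atMost)
  qed simp
  finally show ?thesis .
qed

text \<open>Differences commute with translations, so the operator E^c - 1 may act first, directly
  on \<open>g\<close>.\<close>

lemma fdiff_funpow_shift_diff:
  "(fdiff ^^ k) g (y + c) - (fdiff ^^ k) g y = (fdiff ^^ k) (\<lambda>z. g (z + c) - g z) y"
proof (induction k arbitrary: y)
  case (Suc k)
  show ?case
    using Suc[of "y + 1"] Suc[of y] by (simp add: fdiff_def algebra_simps)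
qed simp

text \<open>\<open>pcompose F [:1, 1:]\<close> and \<open>F\<close> share their leading term, so a
  difference is again a polynomial function, of lower degree.\<close>

lemma fdiff_funpow_poly_eq_0:
  fixes F :: "'a::idom poly"
  assumes "degree F < j"
  shows "(fdiff ^^ j) (\<lambda>z. poly F (of_int z)) = (\<lambda>_. 0)"
  using assms
proof (induction j arbitrary: F)
  case (Suc j)
  define G where "G = pcompose F [:1, 1:] - F"
  have G: "fdiff (\<lambda>z. poly F (of_int z)) = (\<lambda>z. poly G (of_int z))"
    by (simp add: fdiff_def G_def poly_pcompose fun_eq_iff add.commute)
  show ?case
  \<comment> \<open>Constants have difference zero outright; their \<open>degree\<close> has no room
    to drop.\<close>
  proof (cases "degree F = 0")
    case True
    then obtain c where "F = [:c:]" by (rule degree_eq_zeroE)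
    then have "fdiff (\<lambda>z. poly F (of_int z)) = (\<lambda>_. 0)" by (simp add: fdiff_def)
    then show ?thesis by (simp add: funpow_Suc_right del: funpow.simps(2))
  next
    case False
    have "coeff G i = 0" if "i \<ge> degree F" for i
    proof (cases "i = degree F")
      case True
      have "lead_coeff (pcompose F [:1, 1:]) = lead_coeff F \<and> degree (pcompose F [:1, 1:]) = degree F"
        using lead_coeff_comp[of "[:1, 1:]" F] by (simp add: degree_pcompose)
      then show ?thesis by (simp add: G_def True)
    next
      case False
      have "degree (pcompose F [:1, 1:]) \<le> degree F"
        using degree_pcompose_le[of F "[:1, 1:]"] by simp
      then show ?thesis using False that by (simp add: G_def coeff_eq_0)
    qed
    then have "degree G < degree F"
      using False by (metis degree_0 leading_coeff_0_iff not_le not_gr_zero)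
    with Suc have "(fdiff ^^ j) (\<lambda>z. poly G (of_int z)) = (\<lambda>_. 0)" by simp
    then show ?thesis by (simp add: G funpow_Suc_right del: funpow.simps(2))
  qed
qed simp

text \<open>Extension by zero off the multiples of q builds the divisibility restriction of the sum
  into the summand.\<close>

definition dilate :: "nat \<Rightarrow> (int \<Rightarrow> 'a::zero) \<Rightarrow> int \<Rightarrow> 'a" where
  "dilate q h y = (if int q dvd y then h (y div int q) else 0)"

lemma dilate_zero [simp]: "dilate q (\<lambda>_. 0) = (\<lambda>_. 0)"
  by (simp add: dilate_def fun_eq_iff)

text \<open>The integers y and y + q are multiples of q together, and the quotient then moves by
  exactly 1.\<close>

lemma dilate_shift_diff:
  assumes "q > 0"
  shows "(\<lambda>y. dilate q h (y + int q) - dilate q h y) = dilate q (fdiff h)"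
  using assms by (auto simp: dilate_def fdiff_def fun_eq_iff)

text \<open>Let q = p^a, let v be the exponent of p in i, and t = a - v. The identity i * (q choose
  i) = q * (q - 1 choose i - 1) supplies p^t. The inequality bounds the lost order q - i by t steps
  of size \<phi>(q), one for each factor p gained. It follows from p^v \<le> i, using \<phi>(q) = q
  - p^(a - 1) for t = 1 and 2 \<phi>(q) \<ge> q for t \<ge> 2.\<close>

lemma power_dvd_prime_power_choose:
  fixes p :: nat
  assumes p: "prime p" and i: "0 < i" "i < p ^ a"
  obtains t where "p ^ t dvd p ^ a choose i" "p ^ a \<le> i + t * (p ^ a - p ^ (a - 1))"
proof -
  define v where "v = multiplicity p i"
  have pv: "p ^ v dvd i" unfolding v_def by (rule multiplicity_dvd)
  then have "p ^ v \<le> i" using i by (simp add: dvd_imp_le)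
  then have "p ^ v < p ^ a" using i by simp
  then have va: "v < a" using p prime_gt_1_nat by (meson power_less_imp_less_exp)
  obtain w where w: "i = p ^ v * w" using pv by blast
  have cop: "\<not> p dvd w"
    using multiplicity_decompose[of i p] p i prime_gt_1_nat[OF p] unfolding v_def[symmetric] by (simp add: w)
  have "i * (p ^ a choose i) = p ^ a * ((p ^ a - 1) choose (i - 1))"
    using i by (metis One_nat_def Suc_diff_1 Suc_times_binomial_eq gr_zeroI less_zeroE mult.commute)
  moreover have "p ^ a = p ^ v * p ^ (a - v)" using va by (simp flip: power_add)
  ultimately have "p ^ v * (w * (p ^ a choose i)) = p ^ v * (p ^ (a - v) * ((p ^ a - 1) choose (i - 1)))"
    using w by (metis mult.assoc)
  moreover have "p ^ v > 0" using p prime_gt_0_nat by simp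
  ultimately have "w * (p ^ a choose i) = p ^ (a - v) * ((p ^ a - 1) choose (i - 1))"
    by (metis mult_cancel1 less_irrefl)
  then have "p ^ (a - v) dvd w * (p ^ a choose i)" by simp
  moreover have "coprime (p ^ (a - v)) w"
    using cop p prime_imp_coprime by (simp add: prime_imp_coprime_nat)
  ultimately have 1: "p ^ (a - v) dvd p ^ a choose i"
    using coprime_dvd_mult_right_iff by blast
  have "p ^ a \<le> p ^ v + (a - v) * (p ^ a - p ^ (a - 1))"
  proof (cases "a - v = 1")
    case True
    then have "v = a - 1" by simp
    then show ?thesis using True by simp
  next
    case False
    with va have "2 \<le> a - v" by simp
    have "p ^ a = p * p ^ (a - 1)" using va by (metis Suc_diff_1 gr_zeroI less_zeroE power_Suc)
    then have "2 * p ^ (a - 1) \<le> p ^ a" using p prime_ge_2_nat by simp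
    then have "p ^ a \<le> 2 * (p ^ a - p ^ (a - 1))" by simp
    also have "\<dots> \<le> (a - v) * (p ^ a - p ^ (a - 1))" using \<open>2 \<le> a - v\<close> by (rule mult_le_mono1)
    finally show ?thesis by simp
  qed
  with \<open>p ^ v \<le> i\<close> have "p ^ a \<le> i + (a - v) * (p ^ a - p ^ (a - 1))" by simp
  with 1 show ?thesis by (rule that)
qed

section \<open>Differences of dilated polynomial functions\<close>

text \<open>Abstract stand-in for the p-adic algebraic integers: the difference estimates use only
  these closure rules.\<close>

locale subring_set =
  fixes R :: "'a::comm_ring_1 set"
  assumes one_closed: "1 \<in> R"
    and diff_closed: "x \<in> R \<Longrightarrow> y \<in> R \<Longrightarrow> x - y \<in> R"
    and mult_closed: "x \<in> R \<Longrightarrow> y \<in> R \<Longrightarrow> x * y \<in> R"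
begin

section \<open>Divisibility relative to a subring\<close>

lemma zero_closed: "0 \<in> R"
  using diff_closed[OF one_closed one_closed] by simp

lemma add_closed: "x \<in> R \<Longrightarrow> y \<in> R \<Longrightarrow> x + y \<in> R"
  using diff_closed[of x "0 - y"] diff_closed[OF zero_closed, of y] by simp

lemma of_nat_closed: "of_nat n \<in> R"
  by (induction n) (auto intro: zero_closed one_closed add_closed)

lemma of_int_closed: "of_int z \<in> R"
  using diff_closed[OF of_nat_closed of_nat_closed]
  by (cases z rule: int_diff_cases) simp

text \<open>In a field \<open>dvd\<close> is trivial, so divisibility by \<open>c\<close> is
  measured with quotients taken from \<open>R\<close>.\<close>

definition multiples :: "'a \<Rightarrow> 'a set" where
  "multiples c = (\<lambda>r. c * r) ` R"

lemma multiplesI: "r \<in> R \<Longrightarrow> x = c * r \<Longrightarrow> x \<in> multiples c"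
  by (simp add: multiples_def)

lemma multiples_one [simp]: "multiples 1 = R"
  by (simp add: multiples_def)

lemma multiples_zero: "0 \<in> multiples c"
  using zero_closed by (auto intro!: multiplesI[of 0])

lemma multiples_diff: "x \<in> multiples c \<Longrightarrow> y \<in> multiples c \<Longrightarrow> x - y \<in> multiples c"
  unfolding multiples_def using diff_closed by (auto simp flip: right_diff_distrib)

lemma multiples_add: "x \<in> multiples c \<Longrightarrow> y \<in> multiples c \<Longrightarrow> x + y \<in> multiples c"
  unfolding multiples_def using add_closed by (auto simp flip: distrib_left)

lemma multiples_sum: "(\<And>i. i \<in> A \<Longrightarrow> u i \<in> multiples c) \<Longrightarrow> sum u A \<in> multiples c"
  by (induction A rule: infinite_finite_induct) (auto intro: multiples_zero multiples_add)

lemma multiples_mult: "x \<in> multiples c \<Longrightarrow> y \<in> multiples d \<Longrightarrow> x * y \<in> multiples (c * d)"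
  unfolding multiples_def
  by (smt (verit, best) imageE image_eqI mult.assoc mult.left_commute mult_closed)

lemma multiples_prod: "(\<And>i. i \<in> A \<Longrightarrow> u i \<in> multiples (c i)) \<Longrightarrow> prod u A \<in> multiples (prod c A)"
  by (induction A rule: infinite_finite_induct)
     (auto intro: multiples_mult one_closed)

lemma multiples_of_nat_dvd: "m dvd n \<Longrightarrow> x \<in> multiples (of_nat n) \<Longrightarrow> x \<in> multiples (of_nat m)"
  unfolding multiples_def by (auto simp: mult.assoc elim!: dvdE intro!: mult_closed of_nat_closed)

lemma of_nat_multiples: "m dvd n \<Longrightarrow> of_nat n \<in> multiples (of_nat m)"
  by (metis dvdE multiplesI of_nat_closed of_nat_mult)

lemma of_int_multiples: "int m dvd z \<Longrightarrow> of_int z \<in> multiples (of_nat m)"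
  by (metis dvdE multiplesI of_int_closed of_int_mult of_int_of_nat_eq)

lemma fdiff_funpow_closed:
  "(\<And>z. h z \<in> R) \<Longrightarrow> (fdiff ^^ j) h y \<in> R"
  by (induction j arbitrary: y) (auto simp: fdiff_def intro: diff_closed)

text \<open>The Fleck--Weisman--Wan congruence. The operator \<open>E ^ q - 1\<close>, where \<open>E\<close> is the unit shift
  and \<open>q = p ^ a\<close>, takes \<open>dilate q h\<close> to \<open>dilate q (fdiff h)\<close>; expanding it in powers of
  \<open>fdiff = E - 1\<close> expresses \<open>fdiff ^ q\<close> by lower powers of \<open>fdiff\<close> with binomial coefficients
  that are divisible by powers of \<open>p\<close>.\<close>

lemma fdiff_funpow_dilate_multiples:
  assumes p: "prime p" and a: "a > 0"
    and "\<And>z. h z \<in> R" and "(fdiff ^^ Suc l) h = (\<lambda>_. 0)"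
    and "e * (p ^ a - p ^ (a - 1)) + l * p ^ a + p ^ (a - 1) \<le> j"
  shows "(fdiff ^^ j) (dilate (p ^ a) h) y \<in> multiples (of_nat (p ^ e))"
  using assms(3-)
proof (induction j arbitrary: h l e y rule: less_induct)
  case (less j)
  define q where "q = p ^ a"
  define \<phi> where "\<phi> = p ^ a - p ^ (a - 1)"
  have q0: "q > 0" using p by (simp add: q_def prime_gt_0_nat)
  have "p ^ (a - 1) \<le> p ^ a" using prime_ge_1_nat[OF p] by (intro power_increasing) simp_all
  then have q: "q = \<phi> + p ^ (a - 1)" by (simp add: q_def \<phi>_def)
  define g where "g = dilate q h"
  have gR: "g z \<in> R" for z using less.prems(1) zero_closed by (simp add: g_def dilate_def)
  show ?case
  proof (cases "e = 0")
    case True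
    then show ?thesis using fdiff_funpow_closed[of g] gR by (auto simp: g_def q_def intro: multiplesI)
  next
    case False
    have ej: "e * \<phi> + l * q + p ^ (a - 1) \<le> j" using less.prems(3) by (simp add: q_def \<phi>_def)
    \<comment> \<open>For e > 0 the order j reaches q, so \<open>fdiff ^^ q\<close> can be split off
      and rewritten.\<close>
    have "\<phi> \<le> e * \<phi>" using False by simp
    with ej q have "q \<le> j" by linarith
    then obtain k where k: "j = k + q" by (metis add.commute le_Suc_ex)
    define G where "G = (fdiff ^^ k) g"
    have DG: "(fdiff ^^ i) G = (fdiff ^^ (i + k)) g" for i by (simp add: G_def funpow_add)
    have split: "{..q} = insert 0 (insert q {0<..<q})" using q0 by auto
    have "G (y + int q) = (\<Sum>i\<le>q. of_nat (q choose i) * (fdiff ^^ i) G y)"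
      by (rule newton_forward)
    also have "\<dots> = G y + (fdiff ^^ q) G y + (\<Sum>i\<in>{0<..<q}. of_nat (q choose i) * (fdiff ^^ i) G y)"
      unfolding split using q0 by simp
    finally have eq: "(fdiff ^^ j) g y = (G (y + int q) - G y)
        - (\<Sum>i\<in>{0<..<q}. of_nat (q choose i) * (fdiff ^^ (i + k)) g y)"
      unfolding k by (simp add: DG add.commute)
    \<comment> \<open>Passing to \<open>fdiff h\<close> lowers l by one and hence the required order
      by q, exactly what k lacks compared with j. For l = 0 the term vanishes.\<close>
    have "G (y + int q) - G y = (fdiff ^^ k) (dilate q (fdiff h)) y"
      unfolding G_def g_def by (simp add: fdiff_funpow_shift_diff dilate_shift_diff[OF q0])
    also have "\<dots> \<in> multiples (of_nat (p ^ e))"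
    proof (cases l)
      case 0
      with less.prems(2) show ?thesis by (simp add: multiples_zero)
    next
      case (Suc l')
      have "(fdiff ^^ k) (dilate (p ^ a) (fdiff h)) y \<in> multiples (of_nat (p ^ e))"
      proof (rule less.IH[where l = l'])
        show "k < j" using k q0 by simp
        show "fdiff h z \<in> R" for z using less.prems(1) by (simp add: fdiff_def diff_closed)
        show "(fdiff ^^ Suc l') (fdiff h) = (\<lambda>_. 0)"
          using less.prems(2) Suc by (simp add: funpow_swap1)
        show "e * (p ^ a - p ^ (a - 1)) + l' * p ^ a + p ^ (a - 1) \<le> k"
          using ej Suc k by (simp add: q_def \<phi>_def)
      qed
      then show ?thesis by (simp add: q_def)
    qed
    finally have 1: "G (y + int q) - G y \<in> multiples (of_nat (p ^ e))" .
    \<comment> \<open>The order i + k lies q - i \<le> t * \<phi> below j: the induction hypothesis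
      loses at most t factors p, and the binomial coefficient supplies them.\<close>
    have 2: "of_nat (q choose i) * (fdiff ^^ (i + k)) g y \<in> multiples (of_nat (p ^ e))"
      if i: "i \<in> {0<..<q}" for i
    proof -
      obtain t where t: "p ^ t dvd q choose i" "q \<le> i + t * \<phi>"
        using power_dvd_prime_power_choose[OF p, of i a] i unfolding q_def \<phi>_def by auto
      have "(fdiff ^^ (i + k)) g y \<in> multiples (of_nat (p ^ (e - t)))"
      proof (cases "t < e")
        case True
        then have "e * \<phi> = (e - t) * \<phi> + t * \<phi>"
          by (simp flip: distrib_right)
        with ej t k have "(e - t) * \<phi> + l * q + p ^ (a - 1) \<le> i + k" by linarith
        then show ?thesis
          unfolding g_def q_def \<phi>_def
          by (intro less.IH[where l = l]) (use i k less.prems in \<open>auto simp: q_def\<close>)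
      next
        case False
        then show ?thesis using fdiff_funpow_closed[of g] gR by (auto intro: multiplesI)
      qed
      then have "of_nat (q choose i) * (fdiff ^^ (i + k)) g y
          \<in> multiples (of_nat (p ^ t) * of_nat (p ^ (e - t)))"
        by (intro multiples_mult of_nat_multiples t)
      then have "of_nat (q choose i) * (fdiff ^^ (i + k)) g y
          \<in> multiples (of_nat (p ^ (t + (e - t))))"
        by (simp add: power_add)
      then show ?thesis
        by (rule multiples_of_nat_dvd[rotated]) (simp add: le_imp_power_dvd)
    qed
    have "(fdiff ^^ j) g y \<in> multiples (of_nat (p ^ e))"
      unfolding eq by (intro multiples_diff 1 multiples_sum 2)
    then show ?thesis by (simp add: g_def q_def)
  qed
qed

text \<open>The estimate solved for the order j, the form in which it later bounds a degree. The
  vanishing alternative arises for a = 0, where \<open>dilate\<close> is the identity and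
  differences past order l vanish instead of gaining factors p.\<close>

lemma fdiff_funpow_dilate_cases:
  assumes p: "prime p" and h: "\<And>z. h z \<in> R" "(fdiff ^^ Suc l) h = (\<lambda>_. 0)"
  obtains "(fdiff ^^ j) (dilate (p ^ a) h) y = 0"
  | s where "(fdiff ^^ j) (dilate (p ^ a) h) y \<in> multiples (of_nat (p ^ s))"
      "j + (if a \<noteq> 0 then 1 else 0) \<le> s * totient (p ^ a) + (l + 1) * p ^ a"
proof (cases "a = 0")
  case True
  then have d: "dilate (p ^ a) h = h" by (simp add: dilate_def fun_eq_iff)
  show ?thesis
  proof (cases "j \<le> l")
    case True
    have "(fdiff ^^ j) h y \<in> multiples (of_nat (p ^ 0))"
      using fdiff_funpow_closed[of h] h by (auto intro: multiplesI)
    with True \<open>a = 0\<close> show ?thesis by (intro that(2)[of 0, unfolded d]) auto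
  next
    case False
    then have "j = (j - Suc l) + Suc l" by simp
    then have "(fdiff ^^ j) h = (fdiff ^^ (j - Suc l)) ((fdiff ^^ Suc l) h)"
      by (metis funpow_add comp_apply)
    then show ?thesis using h(2) by (intro that(1)[unfolded d]) simp
  qed
next
  case False
  define \<phi> where "\<phi> = p ^ a - p ^ (a - 1)"
  have tot: "totient (p ^ a) = \<phi>"
    using totient_prime_power[OF p, of a] False
    by (cases a) (simp_all add: \<phi>_def diff_mult_distrib2 mult.commute)
  have "p ^ (a - 1) < p ^ a" using prime_gt_1_nat[OF p] False by simp
  then have q: "p ^ a = \<phi> + p ^ (a - 1)" and \<phi>: "\<phi> > 0" by (simp_all add: \<phi>_def)
  \<comment> \<open>The largest exponent that the estimate allows, or 0 if j is too small. The
    strict remainder bound of the division yields the extra 1 for a \<noteq> 0.\<close>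
  define s where "s = (j - (l * p ^ a + p ^ (a - 1))) div \<phi>"
  have le: "s * \<phi> \<le> j - (l * p ^ a + p ^ (a - 1))" by (simp add: s_def)
  have "j - (l * p ^ a + p ^ (a - 1)) < s * \<phi> + \<phi>"
    using \<phi> unfolding s_def by (metis add.commute dividend_less_div_times)
  then have up: "j + 1 \<le> s * \<phi> + (l + 1) * p ^ a" using q by simp
  have "(fdiff ^^ j) (dilate (p ^ a) h) y \<in> multiples (of_nat (p ^ s))"
  \<comment> \<open>Truncated subtraction hides whether j reaches the threshold; s > 0 guarantees
    that it does.\<close>
  proof (cases "s = 0")
    case True
    have "dilate (p ^ a) h z \<in> R" for z using h zero_closed by (simp add: dilate_def)
    then show ?thesis using True fdiff_funpow_closed by (auto intro: multiplesI)
  next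
    case s: False
    then have "s * \<phi> > 0" using \<phi> by simp
    with le have "s * \<phi> + l * p ^ a + p ^ (a - 1) \<le> j" by linarith
    then show ?thesis
      by (intro fdiff_funpow_dilate_multiples[where l = l]) (use p False h in \<open>auto simp: \<phi>_def\<close>)
  qed
  with up False tot show ?thesis by (intro that(2)[of s]) simp_all
qed

end

section \<open>Sums of integer-valued polynomials over a box\<close>

definition pdiff :: "'i \<Rightarrow> (('i \<Rightarrow> int) \<Rightarrow> int) \<Rightarrow> ('i \<Rightarrow> int) \<Rightarrow> int" where
  "pdiff i G = (\<lambda>x. G (x(i := x i + 1)) - G x)"

text \<open>Measuring degree by vanishing differences keeps integer-valued polynomials with rational
  coefficients, such as binomial coefficients, within functions to the integers.\<close>

primrec diff_degree_le :: "'i set \<Rightarrow> nat \<Rightarrow> (('i \<Rightarrow> int) \<Rightarrow> int) \<Rightarrow> bool" where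
  "diff_degree_le V 0 G \<longleftrightarrow> (\<forall>i\<in>V. pdiff i G = (\<lambda>_. 0))"
| "diff_degree_le V (Suc D) G \<longleftrightarrow> (\<forall>i\<in>V. diff_degree_le V D (pdiff i G))"

lemma pdiff_zero [simp]: "pdiff i (\<lambda>_. 0) = (\<lambda>_. 0)"
  by (simp add: pdiff_def)

lemma diff_degree_le_zero: "diff_degree_le V D (\<lambda>_. 0)"
  by (induction D) simp_all

lemma diff_degree_le_Suc: "diff_degree_le V D G \<Longrightarrow> diff_degree_le V (Suc D) G"
proof (induction D arbitrary: G)
  case 0
  then show ?case using diff_degree_le_zero[of V 0] by simp
next
  case (Suc D)
  then show ?case by (metis diff_degree_le.simps(2))
qed

lemma diff_degree_le_mono:
  assumes "D \<le> D'" and "diff_degree_le V D G"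
  shows "diff_degree_le V D' G"
  using assms by (induction D' rule: dec_induct) (auto simp del: diff_degree_le.simps intro: diff_degree_le_Suc)

lemma diff_degree_le_const: "diff_degree_le V D (\<lambda>_. c)"
  by (rule diff_degree_le_mono[of 0]) (simp_all add: pdiff_def)

section \<open>Degree of sums, products and powers\<close>

lemma diff_degree_le_add:
  "diff_degree_le V D G \<Longrightarrow> diff_degree_le V D H \<Longrightarrow> diff_degree_le V D (\<lambda>x. G x + H x)"
proof (induction D arbitrary: G H)
  case 0
  then show ?case by (auto simp: pdiff_def fun_eq_iff algebra_simps)
next
  case (Suc D)
  have "pdiff i (\<lambda>x. G x + H x) = (\<lambda>x. pdiff i G x + pdiff i H x)" for i
    by (simp add: pdiff_def fun_eq_iff)
  with Suc show ?case by simp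
qed

lemma diff_degree_le_sum:
  "(\<And>t. t \<in> T \<Longrightarrow> diff_degree_le V D (G t)) \<Longrightarrow> diff_degree_le V D (\<lambda>x. \<Sum>t\<in>T. G t x)"
  by (induction T rule: infinite_finite_induct) (simp_all add: diff_degree_le_zero diff_degree_le_add)

lemma pdiff_shift: "pdiff j (\<lambda>x. G (x(i := x i + 1))) = (\<lambda>x. pdiff j G (x(i := x i + 1)))"
  by (cases "j = i") (auto simp: pdiff_def fun_eq_iff fun_upd_twist)

text \<open>The discrete Leibniz rule shifts one factor, which must not cost degree.\<close>

lemma diff_degree_le_shift:
  "diff_degree_le V D G \<Longrightarrow> diff_degree_le V D (\<lambda>x. G (x(i := x i + 1)))"
proof (induction D arbitrary: G)
  case 0
  then show ?case unfolding diff_degree_le.simps pdiff_shift by simp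
next
  case (Suc D)
  then show ?case unfolding diff_degree_le.simps pdiff_shift by blast
qed

text \<open>Induction on D + D' through the Leibniz rule. A factor with bound 0 has zero difference,
  so its summand drops out and no negative bound arises.\<close>

lemma diff_degree_le_mult:
  assumes "diff_degree_le V D G" and "diff_degree_le V D' H"
  shows "diff_degree_le V (D + D') (\<lambda>x. G x * H x)"
  using assms
proof (induction "D + D'" arbitrary: D D' G H)
  case 0
  then show ?case by (auto simp: pdiff_def fun_eq_iff)
next
  case (Suc N)
  have leibniz: "pdiff i (\<lambda>x. G x * H x) = (\<lambda>x. pdiff i G x * H x + G (x(i := x i + 1)) * pdiff i H x)" for i
    by (simp add: pdiff_def fun_eq_iff algebra_simps)
  have "diff_degree_le V N (pdiff i (\<lambda>x. G x * H x))" if "i \<in> V" for i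
  proof -
    have 1: "diff_degree_le V N (\<lambda>x. pdiff i G x * H x)"
    proof (cases D)
      case 0
      then show ?thesis using Suc.prems(1) that by (simp add: diff_degree_le_zero)
    next
      case (Suc E)
      with \<open>Suc N = D + D'\<close> have N: "N = E + D'" by simp
      show ?thesis unfolding N by (rule Suc.hyps(1)) (use N Suc Suc.prems that in auto)
    qed
    have 2: "diff_degree_le V N (\<lambda>x. G (x(i := x i + 1)) * pdiff i H x)"
    proof (cases D')
      case 0
      then show ?thesis using Suc.prems(2) that by (simp add: diff_degree_le_zero)
    next
      case (Suc E)
      with \<open>Suc N = D + D'\<close> have N: "N = D + E" by simp
      show ?thesis unfolding N
        by (rule Suc.hyps(1)) (use N Suc Suc.prems that in \<open>auto intro: diff_degree_le_shift\<close>)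
    qed
    show ?thesis unfolding leibniz by (rule diff_degree_le_add[OF 1 2])
  qed
  then show ?case by (simp flip: Suc.hyps(2))
qed

lemma diff_degree_le_prod:
  "(\<And>t. t \<in> T \<Longrightarrow> diff_degree_le V (D t) (G t)) \<Longrightarrow>
    diff_degree_le V (\<Sum>t\<in>T. D t) (\<lambda>x. \<Prod>t\<in>T. G t x)"
  by (induction T rule: infinite_finite_induct)
     (simp_all add: diff_degree_le_const diff_degree_le_mult del: diff_degree_le.simps)

lemma diff_degree_le_power:
  "diff_degree_le V D G \<Longrightarrow> diff_degree_le V (n * D) (\<lambda>x. G x ^ n)"
  using diff_degree_le_prod[of "{..<n}" V "\<lambda>_. D" "\<lambda>_. G"] by simp

lemma diff_degree_le_coord: "diff_degree_le V 1 (\<lambda>x. x i)"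
proof -
  have "pdiff j (\<lambda>x. x i) = (\<lambda>_. if j = i then 1 else 0)" for j
    by (auto simp: pdiff_def)
  then show ?thesis by (auto simp: pdiff_def)
qed

text \<open>Differences commute with multiplication by \<open>c\<close>, which is cancellable. With
  \<open>c = fact j\<close> this carries the degree of a falling factorial over to the binomial
  coefficient.\<close>

lemma diff_degree_le_mult_cancel:
  assumes "c \<noteq> 0"
  shows "diff_degree_le V D (\<lambda>x. c * G x) \<Longrightarrow> diff_degree_le V D G"
proof (induction D arbitrary: G)
  case 0
  with assms show ?case by (simp add: pdiff_def fun_eq_iff flip: right_diff_distrib)
next
  case (Suc D)
  have "pdiff i (\<lambda>x. c * G x) = (\<lambda>x. c * pdiff i G x)" for i
    by (simp add: pdiff_def fun_eq_iff right_diff_distrib)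
  with Suc show ?case by simp
qed

text \<open>This is \<open>gchoose\<close> on integers written out; the division is exact. Negative
  arguments matter because \<open>diff_degree_le\<close> quantifies over all points, not only those
  of the box.\<close>

definition int_choose :: "int \<Rightarrow> nat \<Rightarrow> int" where
  "int_choose x j = (\<Prod>i = 0..<j. x - int i) div fact j"

lemma fact_mult_int_choose: "fact j * int_choose x j = (\<Prod>i = 0..<j. x - int i)"
  unfolding int_choose_def by (rule gbinomial_int_mult_fact[unfolded gbinomial_prod_rev])

lemma int_choose_of_nat: "int_choose (int n) j = int (n choose j)"
  unfolding int_choose_def by (rule int_binomial[unfolded gbinomial_prod_rev, symmetric])

lemma diff_degree_le_int_choose:
  assumes "diff_degree_le V D G"
  shows "diff_degree_le V (j * D) (\<lambda>x. int_choose (G x) j)"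
proof -
  have "diff_degree_le V D (\<lambda>x. G x - int i)" for i
    using diff_degree_le_add[OF assms diff_degree_le_const[of V D "- int i"]] by simp
  then have "diff_degree_le V (j * D) (\<lambda>x. \<Prod>i = 0..<j. G x - int i)"
    using diff_degree_le_prod[of "{0..<j}" V "\<lambda>_. D" "\<lambda>i x. G x - int i"] by simp
  then have "diff_degree_le V (j * D) (\<lambda>x. fact j * int_choose (G x) j)"
    by (simp only: fact_mult_int_choose)
  then show ?thesis by (rule diff_degree_le_mult_cancel[rotated]) simp
qed

lemma diff_degree_le_mpoly_eval: "diff_degree_le V (mpoly_total_degree f) (mpoly_eval f)"
proof -
  have "diff_degree_le V (mpoly_total_degree f)
      (\<lambda>x. Poly_Mapping.lookup f t * (\<Prod>i\<in>Poly_Mapping.keys t. x i ^ Poly_Mapping.lookup t i))" if t: "t \<in> Poly_Mapping.keys f" for t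
  proof -
    have "diff_degree_le V (\<Sum>i\<in>Poly_Mapping.keys t. Poly_Mapping.lookup t i * 1) (\<lambda>x. \<Prod>i\<in>Poly_Mapping.keys t. x i ^ Poly_Mapping.lookup t i)"
      by (intro diff_degree_le_prod diff_degree_le_power diff_degree_le_coord)
    then have "diff_degree_le V (0 + monom_degree t) (\<lambda>x. Poly_Mapping.lookup f t * (\<Prod>i\<in>Poly_Mapping.keys t. x i ^ Poly_Mapping.lookup t i))"
      by (intro diff_degree_le_mult diff_degree_le_const) (simp add: monom_degree_def)
    moreover have "0 + monom_degree t \<le> mpoly_total_degree f"
      using t by (simp add: mpoly_total_degree_def)
    ultimately show ?thesis using diff_degree_le_mono by blast
  qed
  then show ?thesis
    unfolding mpoly_eval_def by (rule diff_degree_le_sum)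
qed

section \<open>Iterated partial differences and freezing a variable\<close>

lemma diff_degree_le_funpow_pdiff:
  assumes "i \<in> V"
  shows "diff_degree_le V D G \<Longrightarrow> s \<le> D \<Longrightarrow> diff_degree_le V (D - s) ((pdiff i ^^ s) G)"
proof (induction s arbitrary: D G)
  case (Suc s)
  then obtain D' where "D = Suc D'" by (cases D) auto
  with Suc assms show ?case
    by (simp add: funpow_Suc_right del: funpow.simps(2))
qed simp

lemma funpow_pdiff_eq_zero:
  assumes "i \<in> V" and "diff_degree_le V D G" and "D < s"
  shows "(pdiff i ^^ s) G = (\<lambda>_. 0)"
proof -
  have z: "(pdiff i ^^ k) (\<lambda>_. 0) = (\<lambda>_. 0)" for k
    by (induction k) simp_all
  have "diff_degree_le V 0 ((pdiff i ^^ D) G)"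
    using diff_degree_le_funpow_pdiff[OF assms(1,2), of D] by simp
  then have "(pdiff i ^^ Suc D) G = (\<lambda>_. 0)" using assms(1) by simp
  moreover have "s = (s - Suc D) + Suc D" using assms(3) by simp
  ultimately show ?thesis by (metis funpow_add comp_apply z)
qed

lemma pdiff_subst:
  "j \<noteq> i \<Longrightarrow> pdiff j (\<lambda>x. G (x(i := c))) = (\<lambda>x. pdiff j G (x(i := c)))"
  by (auto simp: pdiff_def fun_eq_iff fun_upd_twist)

text \<open>Freezing coordinate i commutes with the differences along \<open>V\<close>, which all
  avoid i. This lets the box be summed one variable at a time.\<close>

lemma diff_degree_le_subst:
  assumes "i \<notin> V" and "diff_degree_le (insert i V) D G"
  shows "diff_degree_le V D (\<lambda>x. G (x(i := c)))"
  using assms(2)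
proof (induction D arbitrary: G)
  case 0
  have "pdiff j (\<lambda>x. G (x(i := c))) = (\<lambda>_. 0)" if "j \<in> V" for j
  proof -
    have "j \<noteq> i" using that assms(1) by blast
    then show ?thesis using 0 that by (simp add: pdiff_subst)
  qed
  then show ?case unfolding diff_degree_le.simps by blast
next
  case (Suc D)
  have "diff_degree_le V D (pdiff j (\<lambda>x. G (x(i := c))))" if "j \<in> V" for j
  proof -
    have "diff_degree_le V D (\<lambda>x. pdiff j G (x(i := c)))"
      using that Suc.prems by (intro Suc.IH) simp
    then show ?thesis using that assms(1) pdiff_subst[of j i] by metis
  qed
  then show ?case unfolding diff_degree_le.simps by blast
qed

lemma fdiff_funpow_fun_upd:
  "(fdiff ^^ s) (\<lambda>t. G (x(i := t))) t = (pdiff i ^^ s) G (x(i := t))"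
  by (induction s arbitrary: t) (simp_all add: fdiff_def pdiff_def)

text \<open>Summing over one variable replaces \<open>G\<close> by \<open>\<Sum>s<p. (p choose Suc s) * (pdiff i ^^ s) G\<close>
  at \<open>x i = 0\<close>: each term either gains a factor \<open>p\<close> or, for \<open>s = p - 1\<close>, loses \<open>p - 1\<close>
  in degree.\<close>

lemma power_dvd_sum_box:
  assumes p: "prime p" and "finite V"
    and "diff_degree_le V D G" and "D + e * (p - 1) < (card V + 1) * (p - 1)"
  shows "int p ^ e dvd (\<Sum>x\<in>V \<rightarrow>\<^sub>E {0..int p - 1}. G x)"
  using assms(2-)
proof (induction V arbitrary: D G e rule: finite_induct)
  case empty
  have "e = 0"
  proof (rule ccontr)
    assume "e \<noteq> 0"
    then have "p - 1 \<le> e * (p - 1)" by (cases e) simp_all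
    moreover have "D + e * (p - 1) < p - 1" using empty by simp
    ultimately show False by linarith
  qed
  then show ?case by simp
next
  case (insert i V)
  have box: "{0..int p - 1} = int ` {..<p}"
    using zero_le_imp_eq_int by (fastforce simp: image_iff)
  have "(\<Sum>x\<in>insert i V \<rightarrow>\<^sub>E {0..int p - 1}. G x)
      = (\<Sum>(t, x)\<in>{0..int p - 1} \<times> (V \<rightarrow>\<^sub>E {0..int p - 1}). G (x(i := t)))"
    unfolding PiE_insert_eq
    by (subst sum.reindex) (use inj_combinator[OF insert(2)] in \<open>auto simp: case_prod_unfold\<close>)
  also have "\<dots> = (\<Sum>x\<in>V \<rightarrow>\<^sub>E {0..int p - 1}. \<Sum>t\<in>{0..int p - 1}. G (x(i := t)))"
    by (subst sum.swap) (simp add: sum.cartesian_product)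
  also have "\<dots> = (\<Sum>x\<in>V \<rightarrow>\<^sub>E {0..int p - 1}. \<Sum>t<p. G (x(i := int t)))"
    unfolding box by (simp add: sum.reindex)
  also have "\<dots> = (\<Sum>x\<in>V \<rightarrow>\<^sub>E {0..int p - 1}. \<Sum>s<p. int (p choose Suc s) * (pdiff i ^^ s) G (x(i := 0)))"
    by (simp add: sum_newton_forward[of "\<lambda>t. G (_(i := t))"] fdiff_funpow_fun_upd)
  also have "\<dots> = (\<Sum>s<p. int (p choose Suc s) * (\<Sum>x\<in>V \<rightarrow>\<^sub>E {0..int p - 1}. (pdiff i ^^ s) G (x(i := 0))))"
    by (subst sum.swap) (simp add: sum_distrib_left)
  finally have eq: "(\<Sum>x\<in>insert i V \<rightarrow>\<^sub>E {0..int p - 1}. G x) = \<dots>" .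
  have "int p ^ e dvd int (p choose Suc s) * (\<Sum>x\<in>V \<rightarrow>\<^sub>E {0..int p - 1}. (pdiff i ^^ s) G (x(i := 0)))"
    if s: "s < p" for s
  \<comment> \<open>Past order D the difference vanishes; otherwise D - s is a true subtraction and
    fits the arithmetic.\<close>
  proof (cases "D < s")
    case True
    then have "(pdiff i ^^ s) G = (\<lambda>_. 0)"
      using funpow_pdiff_eq_zero[OF _ insert.prems(1)] by simp
    then show ?thesis by simp
  next
    case False
    have deg: "diff_degree_le V (D - s) (\<lambda>x. (pdiff i ^^ s) G (x(i := 0)))"
      by (intro diff_degree_le_subst diff_degree_le_funpow_pdiff) (use insert False in auto)
    have c: "card (insert i V) = Suc (card V)" using insert by simp
    show ?thesis
    \<comment> \<open>Removing i lowers the right side of the numerical hypothesis by p - 1. For s =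
      p - 1 the drop in degree pays for this with e unchanged; otherwise the factor p lets e fall by
      one.\<close>
    proof (cases "s = p - 1")
      case True
      have "(D - s) + e * (p - 1) < (card V + 1) * (p - 1)"
        using insert.prems(2) False unfolding c True[symmetric] by (simp add: not_less)
      from dvd_mult[OF insert.IH[OF deg this]] show ?thesis .
    next
      case False
      with s have "p dvd p choose Suc s" by (intro dvd_choose_prime) (use p in auto)
      then have 1: "int p dvd int (p choose Suc s)" by simp
      show ?thesis
      proof (cases e)
        case (Suc e')
        have "(D - s) + e' * (p - 1) < (card V + 1) * (p - 1)"
          using insert.prems(2) unfolding c Suc by simp
        from mult_dvd_mono[OF 1 insert.IH[OF deg this]] show ?thesis unfolding Suc power_Suc .
      qed simp
    qed
  qed
  then show ?case unfolding eq by (intro dvd_sum) simp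
qed

section \<open>Integral elements form a ring\<close>

text \<open>The determinant trick: \<open>c\<close> is a matrix over the base ring with eigenvector
  \<open>v\<close>, nonzero at \<open>i0\<close>, and its characteristic polynomial is monic and
  vanishes at \<gamma>.\<close>

lemma eigenvalue_imp_integral:
  fixes hom :: "'a::comm_ring_1 \<Rightarrow> 'b::field" and v :: "'i \<Rightarrow> 'b"
  assumes hom: "comm_ring_hom hom" and I: "finite I" "i0 \<in> I" "v i0 \<noteq> 0"
    and ev: "\<And>i. i \<in> I \<Longrightarrow> \<gamma> * v i = (\<Sum>j\<in>I. hom (c i j) * v j)"
  shows "\<exists>q. lead_coeff q = 1 \<and> poly (map_poly hom q) \<gamma> = 0"
proof -
  interpret comm_ring_hom hom by (rule hom)
  define N where "N = card I"
  obtain e where e: "bij_betw e {0..<N} I"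
    using ex_bij_betw_nat_finite[OF I(1)] unfolding N_def by blast
  define A where "A = mat N N (\<lambda>(i, j). c (e i) (e j))"
  define w where "w = vec N (\<lambda>i. v (e i))"
  have A: "A \<in> carrier_mat N N" by (simp add: A_def)
  obtain k where k: "k < N" "e k = i0"
    using e I(2) unfolding bij_betw_def by (metis atLeastLessThan_iff imageE)
  have "map_mat hom A *\<^sub>v w = \<gamma> \<cdot>\<^sub>v w"
  proof (rule eq_vecI)
    fix i assume "i < dim_vec (\<gamma> \<cdot>\<^sub>v w)"
    then have i: "i < N" by (simp add: w_def)
    then have "(map_mat hom A *\<^sub>v w) $ i = (\<Sum>j\<in>{0..<N}. hom (c (e i) (e j)) * v (e j))"
      by (simp add: A_def w_def scalar_prod_def)
    also have "\<dots> = (\<Sum>j\<in>I. hom (c (e i) j) * v j)"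
      by (rule sum.reindex_bij_betw[OF e])
    also have "\<dots> = \<gamma> * v (e i)"
      using ev[of "e i"] e i by (auto simp: bij_betw_def)
    finally show "(map_mat hom A *\<^sub>v w) $ i = (\<gamma> \<cdot>\<^sub>v w) $ i" using i by (simp add: w_def)
  qed (simp add: A_def w_def)
  moreover have "w \<noteq> 0\<^sub>v N"
  proof
    assume "w = 0\<^sub>v N"
    then have "w $ k = 0" using k by simp
    then show False using k I(3) by (simp add: w_def)
  qed
  ultimately have "eigenvalue (map_mat hom A) \<gamma>"
    unfolding eigenvalue_def eigenvector_def by (intro exI[of _ w]) (simp add: A_def w_def)
  then have "poly (char_poly (map_mat hom A)) \<gamma> = 0"
    using eigenvalue_root_char_poly[of "map_mat hom A" N] A by simp
  then show ?thesis
    using char_poly_hom[OF A] degree_monic_char_poly[OF A] by (intro exI[of _ "char_poly A"]) simp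
qed

lemma monic_root_power:
  fixes hom :: "'a::comm_ring_1 \<Rightarrow> 'b::field"
  assumes hom: "comm_ring_hom hom" and q: "lead_coeff q = 1" "poly (map_poly hom q) \<alpha> = 0"
  shows "\<alpha> ^ degree q = (\<Sum>i<degree q. hom (- coeff q i) * \<alpha> ^ i)"
proof -
  interpret comm_ring_hom hom by (rule hom)
  have deg: "degree (map_poly hom q) = degree q"
    using q(1) by (intro degree_map_poly) auto
  have "0 = (\<Sum>i\<le>degree q. hom (coeff q i) * \<alpha> ^ i)"
    using q(2) by (simp add: poly_altdef deg coeff_map_poly)
  also have "\<dots> = (\<Sum>i<degree q. hom (coeff q i) * \<alpha> ^ i) + \<alpha> ^ degree q"
    using q(1) by (simp add: lessThan_Suc_atMost[symmetric])
  finally show ?thesis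
    by (simp add: hom_uminus sum_negf eq_neg_iff_add_eq_0 add.commute)
qed

text \<open>The products \<alpha>^i \<beta>^j with exponents below the two degrees span a module
  \<open>S\<close> stable under \<alpha> and \<beta>, hence under their difference and product. The
  determinant trick then applies to both.\<close>

lemma integral_diff_mult:
  fixes hom :: "'a::comm_ring_1 \<Rightarrow> 'b::field"
  assumes hom: "comm_ring_hom hom"
    and f: "lead_coeff f = 1" "poly (map_poly hom f) \<alpha> = 0"
    and g: "lead_coeff g = 1" "poly (map_poly hom g) \<beta> = 0"
  shows "\<exists>q. lead_coeff q = 1 \<and> poly (map_poly hom q) (\<alpha> - \<beta>) = 0"
    and "\<exists>q. lead_coeff q = 1 \<and> poly (map_poly hom q) (\<alpha> * \<beta>) = 0"
proof -
  interpret comm_ring_hom hom by (rule hom)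
  define I where "I = {..<degree f} \<times> {..<degree g}"
  define v where "v = (\<lambda>(i, j). \<alpha> ^ i * \<beta> ^ j)"
  define S where "S = range (\<lambda>c. \<Sum>u\<in>I. hom (c u) * v u)"
  have I: "finite I" by (simp add: I_def)
  have SI: "(\<Sum>u\<in>I. hom (c u) * v u) \<in> S" for c by (simp add: S_def)
  have S0: "0 \<in> S" using SI[of "\<lambda>_. 0"] by simp
  have Sadd: "x + y \<in> S" if "x \<in> S" "y \<in> S" for x y
  proof -
    obtain c d where "x = (\<Sum>u\<in>I. hom (c u) * v u)" "y = (\<Sum>u\<in>I. hom (d u) * v u)"
      using \<open>x \<in> S\<close> \<open>y \<in> S\<close> unfolding S_def by blast
    then have "x + y = (\<Sum>u\<in>I. hom (c u + d u) * v u)"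
      by (simp add: sum.distrib hom_add distrib_right)
    then show ?thesis using SI[of "\<lambda>u. c u + d u"] by simp
  qed
  have Sscale: "hom r * x \<in> S" if "x \<in> S" for r x
  proof -
    obtain c where "x = (\<Sum>u\<in>I. hom (c u) * v u)" using \<open>x \<in> S\<close> unfolding S_def by blast
    then have "hom r * x = (\<Sum>u\<in>I. hom (r * c u) * v u)"
      by (simp add: sum_distrib_left hom_mult mult.assoc)
    then show ?thesis using SI[of "\<lambda>u. r * c u"] by simp
  qed
  have Ssum: "(\<And>t. t \<in> T \<Longrightarrow> x t \<in> S) \<Longrightarrow> sum x T \<in> S" for x :: "'c \<Rightarrow> 'b" and T
    by (induction T rule: infinite_finite_induct) (auto intro: S0 Sadd)
  have Sdiff: "x - y \<in> S" if "x \<in> S" "y \<in> S" for x y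
    using Sadd[OF \<open>x \<in> S\<close> Sscale[OF \<open>y \<in> S\<close>, of "- 1"]] by (simp add: hom_uminus)
  have Sv: "v u \<in> S" if "u \<in> I" for u
  proof -
    have "v u = (\<Sum>w\<in>I. hom (if w = u then 1 else 0) * v w)"
      using that I by (simp add: if_distrib[of hom] if_distrib[of "\<lambda>c. c * _"] sum.delta cong: if_cong)
    then show ?thesis using SI[of "\<lambda>w. if w = u then 1 else 0"] by simp
  qed
  have S\<alpha>: "\<alpha> * v u \<in> S" if "u \<in> I" for u
  proof -
    obtain i j where u: "u = (i, j)" "i < degree f" "j < degree g" using \<open>u \<in> I\<close> by (auto simp: I_def)
    show ?thesis
    \<comment> \<open>Multiplication by \<alpha> leaves the index range only at the top exponent,
      where the monic equation rewrites the power.\<close>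
    proof (cases "Suc i = degree f")
      case False
      with u have "\<alpha> * v u = v (Suc i, j)" "(Suc i, j) \<in> I" by (auto simp: v_def I_def)
      then show ?thesis using Sv by simp
    next
      case True
      then have "\<alpha> * v u = \<alpha> ^ degree f * \<beta> ^ j" by (simp add: u v_def flip: True)
      also have "\<dots> = (\<Sum>i<degree f. hom (- coeff f i) * v (i, j))"
        by (subst monic_root_power[OF hom f]) (simp add: sum_distrib_right v_def mult.assoc)
      also have "\<dots> \<in> S" by (intro Ssum Sscale Sv) (use u in \<open>simp add: I_def\<close>)
      finally show ?thesis .
    qed
  qed
  have S\<beta>: "\<beta> * v u \<in> S" if "u \<in> I" for u
  proof -
    obtain i j where u: "u = (i, j)" "i < degree f" "j < degree g" using \<open>u \<in> I\<close> by (auto simp: I_def)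
    show ?thesis
    proof (cases "Suc j = degree g")
      case False
      with u have "\<beta> * v u = v (i, Suc j)" "(i, Suc j) \<in> I" by (auto simp: v_def I_def)
      then show ?thesis using Sv by simp
    next
      case True
      then have "\<beta> * v u = \<beta> ^ degree g * \<alpha> ^ i" by (simp add: u v_def flip: True)
      also have "\<dots> = (\<Sum>j<degree g. hom (- coeff g j) * v (i, j))"
        by (subst monic_root_power[OF hom g]) (simp add: sum_distrib_left sum_distrib_right v_def ac_simps)
      also have "\<dots> \<in> S" by (intro Ssum Sscale Sv) (use u in \<open>simp add: I_def\<close>)
      finally show ?thesis .
    qed
  qed
  have "\<alpha> * x \<in> S" if "x \<in> S" for x
  proof -
    obtain c where "x = (\<Sum>u\<in>I. hom (c u) * v u)" using \<open>x \<in> S\<close> unfolding S_def by blast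
    then have "\<alpha> * x = (\<Sum>u\<in>I. hom (c u) * (\<alpha> * v u))" by (simp add: sum_distrib_left ac_simps)
    also have "\<dots> \<in> S" by (intro Ssum Sscale S\<alpha>)
    finally show ?thesis .
  qed
  then have S\<alpha>\<beta>: "\<alpha> * \<beta> * v u \<in> S" if "u \<in> I" for u
    using S\<beta>[OF that] by (simp add: mult.assoc)
  have S\<alpha>_\<beta>: "(\<alpha> - \<beta>) * v u \<in> S" if "u \<in> I" for u
    using Sdiff[OF S\<alpha> S\<beta>] that by (simp add: left_diff_distrib)
  \<comment> \<open>A monic constant has no root, so both degrees are positive and the entry 1 at
    (0, 0) makes the eigenvector nonzero.\<close>
  have "degree f \<noteq> 0" using monic_root_power[OF hom f] by (cases "degree f") auto
  moreover have "degree g \<noteq> 0" using monic_root_power[OF hom g] by (cases "degree g") auto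
  ultimately have i0: "(0, 0) \<in> I" "v (0, 0) \<noteq> 0" by (auto simp: I_def v_def)
  have main: "\<exists>q. lead_coeff q = 1 \<and> poly (map_poly hom q) \<gamma> = 0"
    if "\<And>u. u \<in> I \<Longrightarrow> \<gamma> * v u \<in> S" for \<gamma>
  proof -
    have "\<forall>u\<in>I. \<exists>c. \<gamma> * v u = (\<Sum>w\<in>I. hom (c w) * v w)" using that unfolding S_def by blast
    then obtain c where "\<And>u. u \<in> I \<Longrightarrow> \<gamma> * v u = (\<Sum>w\<in>I. hom (c u w) * v w)" by metis
    then show ?thesis by (rule eigenvalue_imp_integral[where v = v, OF hom I i0])
  qed
  show "\<exists>q. lead_coeff q = 1 \<and> poly (map_poly hom q) (\<alpha> - \<beta>) = 0" by (rule main) (rule S\<alpha>_\<beta>)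
  show "\<exists>q. lead_coeff q = 1 \<and> poly (map_poly hom q) (\<alpha> * \<beta>) = 0" by (rule main) (rule S\<alpha>\<beta>)
qed

section \<open>The p-adic algebraic integers\<close>

lemma subring_set_padic_algebraic_ints: "subring_set (padic_algebraic_ints :: 'p::prime_card padic_closure set)"
proof
  have hom: "comm_ring_hom (to_ac \<circ> to_fract :: 'p padic_int \<Rightarrow> _)"
    by unfold_locales simp_all
  show "1 \<in> (padic_algebraic_ints :: 'p padic_closure set)"
    unfolding padic_algebraic_ints_def by (auto intro!: exI[of _ "[:-1, 1:]"] simp: map_poly_pCons)
  fix x y :: "'p padic_closure"
  assume "x \<in> padic_algebraic_ints" "y \<in> padic_algebraic_ints"
  then show "x - y \<in> padic_algebraic_ints" "x * y \<in> padic_algebraic_ints"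
    unfolding padic_algebraic_ints_def using integral_diff_mult[OF hom] by blast+
qed

text \<open>Component 2 decides, since p mod p^2 = p, whereas component 1 is 0. This permits
  cancelling powers of p in the closure.\<close>

lemma of_nat_prime_padic_neq_0: "(of_nat CARD('p) :: 'p::prime_card padic_closure) \<noteq> 0"
proof -
  let ?p = "int CARD('p)"
  have p: "1 < ?p" using prime_card_int[where 'a = 'p] prime_gt_1_int by blast
  have "Rep_padic_int (of_nat m :: 'p padic_int) n = int m mod ?p ^ n" for m n
    by (induction m) (simp_all add: zero_padic_int.rep_eq one_padic_int.rep_eq plus_padic_int.rep_eq mod_simps)
  then have "Rep_padic_int (of_nat CARD('p) :: 'p padic_int) 2 = ?p mod ?p ^ 2" by blast
  also have "\<dots> = ?p" using p by (simp add: power2_eq_square)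
  finally have "(of_nat CARD('p) :: 'p padic_int) \<noteq> 0"
    using p by (auto simp: zero_padic_int.rep_eq)
  moreover have "to_fract (of_nat m :: 'p padic_int) = of_nat m" for m
    by (induction m) simp_all
  ultimately have "(of_nat CARD('p) :: 'p padic) \<noteq> 0" by (metis to_fract_eq_0_iff)
  then show ?thesis by (metis to_ac_eq_0_iff to_ac_of_nat)
qed

section \<open>The congruence\<close>

theorem theorem1p2:
  fixes p m n b :: nat
    and F :: "nat \<Rightarrow> 'p::prime_card padic_closure poly"
    and f :: "nat \<Rightarrow> int_mpoly"
    and l a d :: "nat \<Rightarrow> nat"
  assumes "prime p" and "p = CARD('p)"
    and "m \<ge> 1"
    and "\<And>k. k \<in> {1..m} \<Longrightarrow> degree (F k) \<le> l k"
    and "\<And>k z. k \<in> {1..m} \<Longrightarrow> poly (F k) (of_int z) \<in> padic_algebraic_ints"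
    and "\<And>k. k \<in> {1..m} \<Longrightarrow> mpoly_vars (f k) \<subseteq> {1..n}"
    and "\<And>k. k \<in> {1..m} \<Longrightarrow> f k \<noteq> 0"
    and "\<And>k. k \<in> {1..m} \<Longrightarrow> d k = mpoly_total_degree (f k)"
    and "d 1 * totient (p ^ a 1) = (MAX k\<in>{1..m}. d k * totient (p ^ a k))"
    and "b \<ge> 1"
    and "real n > (real b - 1) * max (real (d 1 * totient (p ^ a 1)) / (real p - 1)) 1
           + 1 / (real p - 1) *
             (\<Sum>k=1..m. ((real (l k) + 1) * real p ^ a k - (if a k \<noteq> 0 then 1 else 0)) * real (d k))"
  shows "(\<Sum>x | x \<in> {1..n} \<rightarrow>\<^sub>E {0..int p - 1} \<and>
                 (\<forall>k\<in>{1..m}. int p ^ a k dvd mpoly_eval (f k) x).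
            \<Prod>k=1..m. poly (F k) (of_int (mpoly_eval (f k) x) / of_nat p ^ a k))
         / of_nat p ^ b \<in> padic_algebraic_ints"
proof -
  note p = \<open>prime p\<close>
  have p2: "p \<ge> 2" using p by (rule prime_ge_2_nat)
  define R :: "'p padic_closure set" where "R = padic_algebraic_ints"
  interpret R: subring_set R unfolding R_def by (rule subring_set_padic_algebraic_ints)
  have pK: "(of_nat p :: 'p padic_closure) \<noteq> 0"
    using of_nat_prime_padic_neq_0[where 'p = 'p] assms(2) by simp
  define K where "K = {1..m}"
  define B where "B = {1..n} \<rightarrow>\<^sub>E {0..int p - 1}"
  define h where "h = (\<lambda>k z. poly (F k) (of_int z))"
  define g where "g = (\<lambda>k. dilate (p ^ a k) (h k))"
  define \<phi> where "\<phi> = (\<lambda>k. totient (p ^ a k))"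
  define \<delta> where "\<delta> = (\<lambda>k. if a k \<noteq> 0 then 1 else 0 :: nat)"
  \<comment> \<open>A crude common bound for all values on the box, so that every
    \<open>E k x\<close> lies between 0 and 2 * C.\<close>
  define C where "C = nat (\<Sum>k\<in>K. \<Sum>x\<in>B. \<bar>mpoly_eval (f k) x\<bar>)"
  define E where "E = (\<lambda>k x. mpoly_eval (f k) x + int C)"
  have fin: "finite K" "finite B" by (auto simp: K_def B_def intro!: finite_PiE)
  have h: "h k z \<in> R" "(fdiff ^^ Suc (l k)) (h k) = (\<lambda>_. 0)" if "k \<in> K" for k z
    using that assms(4,5) fdiff_funpow_poly_eq_0[of "F k" "Suc (l k)"]
    by (auto simp: h_def K_def R_def less_Suc_eq_le simp del: funpow.simps)
  have C: "\<bar>mpoly_eval (f k) x\<bar> \<le> int C" if "k \<in> K" "x \<in> B" for k x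
  proof -
    have "\<bar>mpoly_eval (f k) x\<bar> \<le> (\<Sum>x\<in>B. \<bar>mpoly_eval (f k) x\<bar>)"
      using that fin by (intro member_le_sum) auto
    also have "\<dots> \<le> (\<Sum>k\<in>K. \<Sum>x\<in>B. \<bar>mpoly_eval (f k) x\<bar>)"
      using that fin by (intro member_le_sum) (auto intro: sum_nonneg)
    finally show ?thesis by (simp add: C_def sum_nonneg)
  qed
  \<comment> \<open>The range up to 2 * C is the same for all k and x, so the product of sums
    expands over one set of multi-indices; the added binomials are 0.\<close>
  have newton: "g k (mpoly_eval (f k) x)
      = (\<Sum>j\<le>2 * C. of_int (int_choose (E k x) j) * (fdiff ^^ j) (g k) (- int C))"
    if "k \<in> K" "x \<in> B" for k x
  proof -
    define u where "u = nat (E k x)"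
    have u: "E k x = int u" "u \<le> 2 * C" using C[OF that] by (auto simp: u_def E_def)
    then have "mpoly_eval (f k) x = - int C + int u" by (simp add: E_def)
    then have "g k (mpoly_eval (f k) x) = (\<Sum>j\<le>u. of_nat (u choose j) * (fdiff ^^ j) (g k) (- int C))"
      by (simp only: newton_forward)
    also have "\<dots> = (\<Sum>j\<le>2 * C. of_nat (u choose j) * (fdiff ^^ j) (g k) (- int C))"
      using u(2) by (intro sum.mono_neutral_left) (auto simp: binomial_eq_0 not_le)
    finally show ?thesis by (simp add: u(1) int_choose_of_nat)
  qed
  define coef where "coef = (\<lambda>J. \<Prod>k\<in>K. (fdiff ^^ J k) (g k) (- int C))"
  define box where "box = (\<lambda>J. \<Sum>x\<in>B. \<Prod>k\<in>K. int_choose (E k x) (J k))"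
  let ?S = "\<Sum>x | x \<in> {1..n} \<rightarrow>\<^sub>E {0..int p - 1} \<and> (\<forall>k\<in>{1..m}. int p ^ a k dvd mpoly_eval (f k) x).
      \<Prod>k=1..m. poly (F k) (of_int (mpoly_eval (f k) x) / of_nat p ^ a k)"
  \<comment> \<open>A point that violates some divisibility contributes a factor 0 from
    \<open>dilate\<close>.\<close>
  have "?S = (\<Sum>x\<in>B. \<Prod>k\<in>K. g k (mpoly_eval (f k) x))"
  proof (rule sum.mono_neutral_cong_left)
    show "\<forall>x\<in>B - {x \<in> {1..n} \<rightarrow>\<^sub>E {0..int p - 1}. \<forall>k\<in>{1..m}. int p ^ a k dvd mpoly_eval (f k) x}.
        (\<Prod>k\<in>K. g k (mpoly_eval (f k) x)) = 0"
    proof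
      fix x assume "x \<in> B - {x \<in> {1..n} \<rightarrow>\<^sub>E {0..int p - 1}. \<forall>k\<in>{1..m}. int p ^ a k dvd mpoly_eval (f k) x}"
      then obtain k where "k \<in> K" "\<not> int p ^ a k dvd mpoly_eval (f k) x"
        unfolding B_def K_def by blast
      then have "k \<in> K" "g k (mpoly_eval (f k) x) = 0" by (simp_all add: g_def dilate_def)
      then show "(\<Prod>k\<in>K. g k (mpoly_eval (f k) x)) = 0" by (intro prod_zero fin) blast
    qed
  next
    fix x assume x: "x \<in> {x \<in> {1..n} \<rightarrow>\<^sub>E {0..int p - 1}. \<forall>k\<in>{1..m}. int p ^ a k dvd mpoly_eval (f k) x}"
    have "poly (F k) (of_int (mpoly_eval (f k) x) / of_nat p ^ a k) = g k (mpoly_eval (f k) x)"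
      if k: "k \<in> {1..m}" for k
    proof -
      from x k obtain z where z: "mpoly_eval (f k) x = int p ^ a k * z" by blast
      then show ?thesis using pK p2 by (simp add: g_def dilate_def h_def)
    qed
    then show "(\<Prod>k=1..m. poly (F k) (of_int (mpoly_eval (f k) x) / of_nat p ^ a k))
        = (\<Prod>k\<in>K. g k (mpoly_eval (f k) x))"
      by (simp add: K_def)
  qed (use fin(2) in \<open>auto simp: B_def\<close>)
  also have "\<dots> = (\<Sum>x\<in>B. \<Prod>k\<in>K. \<Sum>j\<le>2 * C. of_int (int_choose (E k x) j) * (fdiff ^^ j) (g k) (- int C))"
    by (rule sum.cong[OF refl], rule prod.cong[OF refl], rule newton)
  also have "\<dots> = (\<Sum>x\<in>B. \<Sum>J\<in>K \<rightarrow>\<^sub>E {..2 * C}. of_int (\<Prod>k\<in>K. int_choose (E k x) (J k)) * coef J)"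
    by (subst prod_sum_PiE) (simp_all add: fin coef_def prod.distrib)
  also have "\<dots> = (\<Sum>J\<in>K \<rightarrow>\<^sub>E {..2 * C}. coef J * of_int (box J))"
    by (subst sum.swap) (simp add: box_def sum_distrib_left mult.commute)
  finally have S: "?S = \<dots>" .
  have "coef J * of_int (box J) \<in> R.multiples (of_nat (p ^ b))" for J
  proof (cases "\<exists>k\<in>K. (fdiff ^^ J k) (g k) (- int C) = 0")
    case True
    then have "coef J = 0" using fin by (simp add: coef_def prod_zero_iff)
    then show ?thesis by (simp add: R.multiples_zero)
  next
    case False
    have "\<exists>s. (fdiff ^^ J k) (g k) (- int C) \<in> R.multiples (of_nat (p ^ s))
        \<and> J k + \<delta> k \<le> s * \<phi> k + (l k + 1) * p ^ a k" if "k \<in> K" for k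
      using R.fdiff_funpow_dilate_cases[OF p, of "h k" "l k" "J k" "a k" "- int C"] h[OF that] False that
      unfolding g_def \<phi>_def \<delta>_def by metis
    then obtain s where s: "\<And>k. k \<in> K \<Longrightarrow> (fdiff ^^ J k) (g k) (- int C) \<in> R.multiples (of_nat (p ^ s k))"
      "\<And>k. k \<in> K \<Longrightarrow> J k + \<delta> k \<le> s k * \<phi> k + (l k + 1) * p ^ a k" by metis
    define t where "t = (\<Sum>k\<in>K. s k)"
    have coef: "coef J \<in> R.multiples (of_nat (p ^ t))"
      using R.multiples_prod[of K, OF s(1)] by (simp add: coef_def t_def power_sum)
    define D where "D = (\<Sum>k\<in>K. J k * d k)"
    have deg: "diff_degree_le {1..n} D (\<lambda>x. \<Prod>k\<in>K. int_choose (E k x) (J k))"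
      unfolding D_def
    proof (intro diff_degree_le_prod diff_degree_le_int_choose)
      fix k assume "k \<in> K"
      then show "diff_degree_le {1..n} (d k) (E k)"
        unfolding E_def using assms(8)
        by (auto simp: K_def intro!: diff_degree_le_add diff_degree_le_const diff_degree_le_mpoly_eval)
    qed
    have box: "int p ^ (b - t) dvd box J"
    \<comment> \<open>For t \<ge> b the factor \<open>coef J\<close> already carries enough powers
      of p, and b - t is 0.\<close>
    proof (cases "t < b")
      case True
      \<comment> \<open>\<open>M\<close> and \<open>Q\<close> are the maximum and the weighted sum
        of the hypothesis on n, cleared of the denominator p - 1.\<close>
      define M where "M = max (real (d 1 * \<phi> 1)) (real p - 1)"
      define Q where "Q = (\<Sum>k\<in>K. ((real (l k) + 1) * real p ^ a k - real (\<delta> k)) * real (d k))"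
      have pos: "real p - 1 > 0" using p2 by simp
      have M: "real (d k * \<phi> k) \<le> M" if "k \<in> K" for k
      proof -
        have "d k * \<phi> k \<le> d 1 * \<phi> 1"
          unfolding \<phi>_def assms(9) using that by (intro Max_ge) (auto simp: K_def)
        then show ?thesis unfolding M_def by (simp add: le_max_iff_disj flip: of_nat_mult)
      qed
      have "real n > (real b - 1) * (M / (real p - 1)) + Q / (real p - 1)"
      proof -
        have "max (real (d 1 * \<phi> 1) / (real p - 1)) 1 = M / (real p - 1)"
          using pos by (simp add: M_def max_divide_distrib_right)
        moreover have "Q = (\<Sum>k=1..m. ((real (l k) + 1) * real p ^ a k - (if a k \<noteq> 0 then 1 else 0)) * real (d k))"
          unfolding Q_def K_def \<delta>_def by (intro sum.cong) auto
        ultimately show ?thesis using assms(11) by (simp add: \<phi>_def)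
      qed
      then have "((real b - 1) * M + Q) / (real p - 1) < real n"
        by (simp add: add_divide_distrib)
      then have "(real b - 1) * M + Q < real n * (real p - 1)"
        using pos by (simp only: pos_divide_less_eq)
      \<comment> \<open>Multiply the bound on J k by d k; maximality of d 1 * \<phi> 1 replaces each
        d k * \<phi> k by \<open>M\<close>.\<close>
      moreover have "real D \<le> real t * M + Q"
      proof -
        have "real (J k * d k) \<le> real (s k) * M + ((real (l k) + 1) * real p ^ a k - real (\<delta> k)) * real (d k)"
          if k: "k \<in> K" for k
        proof -
          have "real (J k + \<delta> k) \<le> real (s k * \<phi> k + (l k + 1) * p ^ a k)"
            using s(2)[OF k] by (simp only: of_nat_le_iff)
          then have "real (J k) \<le> real (s k) * real (\<phi> k) + ((real (l k) + 1) * real p ^ a k - real (\<delta> k))"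
            by (simp add: algebra_simps)
          from mult_right_mono[OF this, of "real (d k)"]
          have "real (J k * d k) \<le> real (s k) * real (d k * \<phi> k)
              + ((real (l k) + 1) * real p ^ a k - real (\<delta> k)) * real (d k)"
            by (simp add: algebra_simps)
          moreover have "real (s k) * real (d k * \<phi> k) \<le> real (s k) * M"
            by (intro mult_left_mono M k) simp
          ultimately show ?thesis by linarith
        qed
        then have "real D \<le> (\<Sum>k\<in>K. real (s k) * M + ((real (l k) + 1) * real p ^ a k - real (\<delta> k)) * real (d k))"
          unfolding D_def of_nat_sum by (rule sum_mono)
        then show ?thesis by (simp add: sum.distrib Q_def t_def sum_distrib_right)
      qed
      \<comment> \<open>The 1 in the maximum gives M \<ge> p - 1. As t \<le> b - 1, the part (b - 1
        - t) * M left over from (b - 1) * M covers the remaining b - 1 - t factors p.\<close>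
      moreover have "real (b - 1 - t) * (real p - 1) \<le> real (b - 1 - t) * M"
        by (intro mult_left_mono) (auto simp: M_def)
      moreover have "real (b - 1 - t) = real b - 1 - real t" using True by linarith
      ultimately have "real D + (real b - 1 - real t) * (real p - 1) < real n * (real p - 1)"
        by (simp add: algebra_simps)
      \<comment> \<open>Adding p - 1 on both sides turns b - 1 - t into b - t and n into n + 1, the
        shape required by \<open>power_dvd_sum_box\<close>.\<close>
      then have "real D + (real b - real t) * (real p - 1) < (real n + 1) * (real p - 1)"
        by (simp add: algebra_simps)
      moreover have "real (b - t) = real b - real t" "real (p - 1) = real p - 1"
        using True p2 by (simp_all add: of_nat_diff)
      ultimately have "real (D + (b - t) * (p - 1)) < real ((card {1..n} + 1) * (p - 1))"
        by (simp only: of_nat_add of_nat_mult of_nat_1 card_atLeastAtMost diff_Suc_1 Suc_eq_plus1 add_diff_cancel_right')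
      then show ?thesis
        unfolding box_def B_def
        by (intro power_dvd_sum_box[OF p _ deg]) (simp_all only: of_nat_less_iff finite_atLeastAtMost)
    qed simp
    have "coef J * of_int (box J) \<in> R.multiples (of_nat (p ^ t) * of_nat (p ^ (b - t)))"
      by (intro R.multiples_mult coef R.of_int_multiples) (use box in simp)
    then have "coef J * of_int (box J) \<in> R.multiples (of_nat (p ^ (t + (b - t))))"
      by (simp add: power_add)
    then show ?thesis
      by (rule R.multiples_of_nat_dvd[rotated]) (simp add: le_imp_power_dvd)
  qed
  then have "?S \<in> R.multiples (of_nat (p ^ b))" unfolding S by (intro R.multiples_sum)
  then obtain r where "r \<in> R" "?S = of_nat p ^ b * r" by (auto simp: R.multiples_def)
  then show ?thesis using pK by (simp add: R_def)
qed

end
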